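(* Let $A$ be a $k\times k$ matrix with characteristic polynomial $P$. Let $$\rho(A)=|\lambda|>|\lambda_2|>\cdots>|\lambda_r|$$ be the eigenvalues of the matrix $A$, i.e., $$P(x)=(x-\lambda)^{m}(x-\lambda_2)^{m_2}\cdots(x-\lambda_r)^{m_r}$$ with $r\le k$. Then, for $0\le j\le k-1$, $$b_j(n)\sim -\lambda^{n-m-j}\,\frac{p_j(\lambda)}{P^{(m)}(\lambda)}\,m!\,\binom{n-k}{m-1},\qquad n\to\infty,$$ where $P^{(m)}(\lambda)=\left.\dfrac{d^mP}{ds^m}\right|_{s=\lambda}$.
   Context: Write the characteristic polynomial of the $k\times k$ matrix $A$ as $P(x)=x^{k}+\sum_{j=0}^{k-1}a_jx^{j}$. The numbers $b_j(n)$, for $0\le j\le k-1$ and integers $n\ge k$, are defined recursively by $b_j(k)=-a_j$ for $0\le j\le k-1$, the convention $b_{-1}(n)=0$ for $n\ge k$, and $b_j(n+1)=b_{j-1}(n)-a_j\,b_{k-1}(n)$ for $n\ge k$, $0\le j\le k-1$. (They satisfy $A^n=\sum_{j=0}^{k-1}b_j(n)A^j$ for $n\ge k$.) The polynomials $p_j$ are $p_j(s)=\sum_{l=0}^{j}a_l s^{l}$, $0\le j\le k-1$. The spectral radius is $\rho(A)=\max\{|\mu| : P(\mu)=0\}$. The symbol $\sim$ denotes asymptotic equivalence as $n\to\infty$.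
   Formalization: The asymptotic equivalence is stated for those j with p_j(λ) ≠ 0; when p_j(λ) = 0 the right-hand side vanishes and the claim fails in general, so b_j(n) = o(λ^{n-m-j} binom(n-k, m-1)) is stated instead. *)

theory Defs
  imports
    "Jordan_Normal_Form.Spectral_Radius"
    "HOL-Library.Landau_Symbols"
begin

text \<open>For a monic polynomial \<open>P\<close> of degree \<open>k\<close> with coefficients \<open>a\<^sub>j\<close>, \<open>b_step P t j\<close> is
  \<open>b\<^sub>j(k + t)\<close>: the recursion starts at \<open>n = k\<close>, hence the shift. The convention
  \<open>b\<^sub>-\<^sub>1(n) = 0\<close> is the case \<open>j = 0\<close>. Only \<open>j < k\<close> is meaningful.\<close>

primrec b_step :: "complex poly \<Rightarrow> nat \<Rightarrow> nat \<Rightarrow> complex" where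
  "b_step P 0 j = - coeff P j"
| "b_step P (Suc t) j =
     (if j = 0 then 0 else b_step P t (j - 1)) - coeff P j * b_step P t (degree P - 1)"

text \<open>This is \<open>b\<^sub>j(n)\<close> for \<open>n \<ge> degree P\<close>; smaller \<open>n\<close> carry no meaning.\<close>

definition b_coeff :: "complex poly \<Rightarrow> nat \<Rightarrow> nat \<Rightarrow> complex" where
  "b_coeff P j n = b_step P (n - degree P) j"

definition p_trunc :: "complex poly \<Rightarrow> nat \<Rightarrow> complex poly" where
  "p_trunc P j = (\<Sum>l\<le>j. monom (coeff P l) l)"

end

theory Submission
  imports Defs "HOL-Computational_Algebra.Polynomial_FPS"
begin

text \<open>
  The proof reads the asymptotics off the generating functions
  \<open>B\<^sub>j = \<Sum>\<^sub>t b\<^sub>j(k + t) X\<^sup>t\<close>. With \<open>G = 1 + X B\<^sub>k\<^sub>-\<^sub>1\<close> the recursion says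
  \<open>B\<^sub>0 = - a\<^sub>0 G\<close> and \<open>B\<^sub>j = X B\<^sub>j\<^sub>-\<^sub>1 - a\<^sub>j G\<close>, so \<open>B\<^sub>j = - R\<^sub>j G\<close> for the polynomial
  \<open>R\<^sub>j = a\<^sub>j + a\<^sub>j\<^sub>-\<^sub>1 X + \<dots> + a\<^sub>0 X\<^sup>j\<close> (lemma \<open>b_fps_eq\<close>). Taking \<open>j = k - 1\<close> and
  substituting into the definition of \<open>G\<close> gives \<open>G \<cdot> P\<^sup>* = 1\<close>, where
  \<open>P\<^sup>* = 1 + X R\<^sub>k\<^sub>-\<^sub>1 = (1 - \<lambda>X)\<^sup>m \<Prod>\<^sub>i (1 - \<lambda>\<^sub>i X)\<close> (with multiplicities) is the
  reflected polynomial (lemma \<open>reflect_poly_times_b_fps\<close>).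

  Hence \<open>B\<^sub>j = - R\<^sub>j / P\<^sup>*\<close>. The coefficients of \<open>(1 - \<lambda>X)\<^sup>-\<^sup>m\<close> are explicit,
  \<open>\<lambda>\<^sup>t (t + m - 1 choose m - 1)\<close>, and their quotient by \<open>\<lambda>\<^sup>t (t choose m - 1)\<close> tends to 1. Every
  remaining factor changes the limit of that quotient only by the value of the factor at
  \<open>1 / \<lambda>\<close>: for the polynomial \<open>R\<^sub>j\<close> because the weight \<open>\<lambda>\<^sup>t (t choose m - 1)\<close> is multiplied by
  asymptotically \<open>\<lambda>\<close> when \<open>t\<close> increases by 1 (lemma \<open>coeff_limit_mult_poly\<close>), and for a division by
  \<open>1 - \<mu>X\<close> with \<open>\<bar>\<mu>\<bar> < \<bar>\<lambda>\<bar>\<close> because the normalised coefficients then satisfy a linear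
  recursion that is asymptotically contracting (lemma \<open>coeff_limit_divide_linear\<close>). Writing
  \<open>P = (x - \<lambda>)\<^sup>m Q\<close>, we get \<open>R\<^sub>j(1/\<lambda>) = p\<^sub>j(\<lambda>) / \<lambda>\<^sup>j\<close>, \<open>Q\<^sup>*(1/\<lambda>) = Q(\<lambda>) / \<lambda>\<^sup>k\<^sup>-\<^sup>m\<close> and
  \<open>P\<^sup>(\<^sup>m\<^sup>)(\<lambda>) = m! Q(\<lambda>)\<close>, which together yield the stated constant. The single limit
  \<open>b_coeff_ratio_tendsto\<close> covers both the equivalence and, if \<open>p\<^sub>j(\<lambda>) = 0\<close>, the small-o statement.
  If \<open>\<lambda> = 0\<close>, then \<open>P = x\<^sup>k\<close> and all \<open>b\<^sub>j(n)\<close> vanish.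
\<close>

section \<open>A perturbed linear recursion\<close>

text \<open>For \<open>q\<close> between \<open>\<bar>\<gamma>\<bar>\<close> and 1 and any \<open>\<epsilon> > 0\<close>, the excess \<open>\<bar>e t\<bar> - \<epsilon>\<close> is eventually
  multiplied by at most \<open>q\<close> in each step, because a perturbation below \<open>\<epsilon> (1 - q)\<close> is just what
  the fixed point \<open>\<epsilon>\<close> of \<open>x \<mapsto> q x + \<epsilon> (1 - q)\<close> absorbs.\<close>

lemma contracting_recursion_null:
  fixes c d e :: "nat \<Rightarrow> complex"
  assumes c: "c \<longlonglongrightarrow> \<gamma>" and "norm \<gamma> < 1" and d: "d \<longlonglongrightarrow> 0"
    and rec: "\<forall>\<^sub>F t in sequentially. e (Suc t) = c t * e t + d t"
  shows "e \<longlonglongrightarrow> 0"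
proof (rule tendstoI)
  fix r :: real assume "r > 0"
  obtain q where q: "norm \<gamma> < q" "q < 1"
    using dense[OF \<open>norm \<gamma> < 1\<close>] by blast
  then have "0 < q"
    using norm_ge_zero[of \<gamma>] by linarith
  define \<epsilon> where "\<epsilon> = r / 2"
  have \<epsilon>: "\<epsilon> > 0" using \<open>r > 0\<close> by (simp add: \<epsilon>_def)
  have "\<forall>\<^sub>F t in sequentially. norm (c t) < q"
    using order_tendstoD(2)[OF tendsto_norm[OF c] q(1)] .
  moreover have "\<forall>\<^sub>F t in sequentially. norm (d t) < \<epsilon> * (1 - q)"
    using order_tendstoD(2)[OF tendsto_norm[OF d], of "\<epsilon> * (1 - q)"] \<epsilon> q(2) by simp
  ultimately have "\<forall>\<^sub>F t in sequentially. norm (e (Suc t)) - \<epsilon> \<le> q * (norm (e t) - \<epsilon>)"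
    using rec
  proof eventually_elim
    case (elim t)
    have "norm (e (Suc t)) \<le> norm (c t) * norm (e t) + norm (d t)"
      using norm_triangle_ineq[of "c t * e t" "d t"] elim(3) by (simp add: norm_mult)
    also have "\<dots> \<le> q * norm (e t) + \<epsilon> * (1 - q)"
      using elim by (intro add_mono mult_right_mono) auto
    finally show ?case by (simp add: algebra_simps)
  qed
  then obtain N where N: "\<And>t. t \<ge> N \<Longrightarrow> norm (e (Suc t)) - \<epsilon> \<le> q * (norm (e t) - \<epsilon>)"
    by (auto simp: eventually_sequentially)
  have geom: "norm (e (s + N)) - \<epsilon> \<le> q ^ s * (norm (e N) - \<epsilon>)" for s
  proof (induction s)
    case (Suc s)
    have "norm (e (Suc s + N)) - \<epsilon> \<le> q * (norm (e (s + N)) - \<epsilon>)"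
      using N[of "s + N"] by simp
    also have "\<dots> \<le> q * (q ^ s * (norm (e N) - \<epsilon>))"
      using Suc \<open>0 < q\<close> by (intro mult_left_mono) auto
    finally show ?case by (simp add: mult_ac)
  qed simp
  have "(\<lambda>s. q ^ s * (norm (e N) - \<epsilon>)) \<longlonglongrightarrow> 0"
    using \<open>0 < q\<close> q(2) by (intro tendsto_mult_left_zero LIMSEQ_power_zero) simp
  then have "\<forall>\<^sub>F s in sequentially. q ^ s * (norm (e N) - \<epsilon>) < \<epsilon>"
    using order_tendstoD(2) \<epsilon> by blast
  then have "\<forall>\<^sub>F s in sequentially. dist (e (s + N)) 0 < r"
  proof eventually_elim
    case (elim s)
    then show ?case using geom[of s] by (simp add: \<epsilon>_def)
  qed
  then show "\<forall>\<^sub>F t in sequentially. dist (e t) 0 < r"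
    by (subst (asm) eventually_sequentially_seg)
qed

text \<open>Subtracting the fixed point \<open>\<delta> / (1 - \<gamma>)\<close> of the limiting recursion reduces this to the null
  case.\<close>

lemma contracting_recursion_limit:
  fixes c d y :: "nat \<Rightarrow> complex"
  assumes c: "c \<longlonglongrightarrow> \<gamma>" and "norm \<gamma> < 1" and d: "d \<longlonglongrightarrow> \<delta>"
    and rec: "\<forall>\<^sub>F t in sequentially. y (Suc t) = c t * y t + d t"
  shows "y \<longlonglongrightarrow> \<delta> / (1 - \<gamma>)"
proof -
  define L where "L = \<delta> / (1 - \<gamma>)"
  have "1 - \<gamma> \<noteq> 0" using \<open>norm \<gamma> < 1\<close> by auto
  then have L: "\<gamma> * L + \<delta> - L = 0"
    by (simp add: L_def field_simps)
  have "(\<lambda>t. c t * L + d t - L) \<longlonglongrightarrow> \<gamma> * L + \<delta> - L"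
    by (intro tendsto_intros c d)
  moreover have "\<forall>\<^sub>F t in sequentially. y (Suc t) - L = c t * (y t - L) + (c t * L + d t - L)"
    using rec by eventually_elim (simp add: algebra_simps)
  ultimately have "(\<lambda>t. y t - L) \<longlonglongrightarrow> 0"
    using contracting_recursion_null[OF c \<open>norm \<gamma> < 1\<close>] L by simp
  then show ?thesis
    unfolding L_def by (simp add: LIM_zero_iff)
qed

section \<open>Power series with a prescribed coefficient growth\<close>

text \<open>The weight is \<open>t choose q\<close> rather than \<open>t\<^sup>q\<close>, so that it is exactly the one in the final formula.
  It vanishes for \<open>t < q\<close>, where the quotient is 0 and carries no information.\<close>

definition coeff_limit :: "complex \<Rightarrow> nat \<Rightarrow> complex fps \<Rightarrow> complex \<Rightarrow> bool" where
  "coeff_limit a q F L \<longleftrightarrow>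
     (\<lambda>t. fps_nth F t / (a ^ t * of_nat (t choose q))) \<longlonglongrightarrow> L"

lemma eventually_binomial_nonzero:
  "\<forall>\<^sub>F t in sequentially. (of_nat (t choose q) :: complex) \<noteq> 0"
  using eventually_ge_at_top[of q] by eventually_elim simp

lemma binomial_ratio_tendsto_1:
  "(\<lambda>t. of_nat (t choose q) / of_nat (Suc t choose q) :: complex) \<longlonglongrightarrow> 1"
proof -
  have "(\<lambda>t. 1 - of_nat q * inverse (of_nat (Suc t)) :: complex) \<longlonglongrightarrow> 1 - of_nat q * 0"
    by (intro tendsto_intros LIMSEQ_Suc[OF lim_inverse_n])
  moreover have "\<forall>\<^sub>F t in sequentially. (1 - of_nat q * inverse (of_nat (Suc t)) :: complex)
      = of_nat (t choose q) / of_nat (Suc t choose q)"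
    using eventually_ge_at_top[of q]
  proof eventually_elim
    case (elim t)
    have "(Suc t - q) * (Suc t choose q) = Suc t * (t choose q)"
      using binomial_absorb_comp[of "Suc t" q] by simp
    then have "(of_nat (Suc t - q) * of_nat (Suc t choose q) :: complex)
        = of_nat (Suc t) * of_nat (t choose q)"
      by (metis of_nat_mult)
    moreover have "(of_nat (Suc t - q) :: complex) = of_nat (Suc t) - of_nat q"
      using elim by (simp add: of_nat_diff)
    moreover have "(of_nat (Suc t choose q) :: complex) \<noteq> 0"
      using elim by (simp del: binomial_Suc_Suc)
    moreover have "(of_nat (Suc t) :: complex) \<noteq> 0"
      by (simp del: of_nat_Suc)
    ultimately show ?case
      by (simp add: divide_simps del: of_nat_Suc)
  qed
  ultimately show ?thesis
    by (simp add: tendsto_cong)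
qed

lemma binomial_shift_ratio_tendsto_1:
  "(\<lambda>t. of_nat ((t + i) choose q) / of_nat (t choose q) :: complex) \<longlonglongrightarrow> 1"
proof (induction i)
  case 0
  have "\<forall>\<^sub>F t in sequentially. (of_nat (t choose q) / of_nat (t choose q) :: complex) = 1"
    using eventually_binomial_nonzero[of q] by eventually_elim simp
  then show ?case by (simp add: tendsto_eventually)
next
  case (Suc i)
  have "(\<lambda>t. of_nat ((t + i) choose q) / of_nat (t choose q)
      * inverse (of_nat ((t + i) choose q) / of_nat (Suc (t + i) choose q)) :: complex)
      \<longlonglongrightarrow> 1 * inverse 1"
    using LIMSEQ_ignore_initial_segment[OF binomial_ratio_tendsto_1[of q], of i]
    by (intro tendsto_mult tendsto_inverse Suc) auto
  moreover have "\<forall>\<^sub>F t in sequentially. of_nat ((t + i) choose q) / of_nat (t choose q)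
      * inverse (of_nat ((t + i) choose q) / of_nat (Suc (t + i) choose q))
      = (of_nat ((t + Suc i) choose q) / of_nat (t choose q) :: complex)"
    using eventually_ge_at_top[of q]
  proof eventually_elim
    case (elim t)
    then have "(of_nat ((t + i) choose q) :: complex) \<noteq> 0" by simp
    then show ?case by (simp add: field_simps del: binomial_Suc_Suc)
  qed
  ultimately show ?case
    by (simp add: tendsto_cong)
qed

lemma coeff_limit_cmult:
  "coeff_limit a q F L \<Longrightarrow> coeff_limit a q (fps_const c * F) (c * L)"
  unfolding coeff_limit_def by (drule tendsto_mult_left[where c = c]) simp

lemma coeff_limit_add:
  "coeff_limit a q F L \<Longrightarrow> coeff_limit a q G M \<Longrightarrow> coeff_limit a q (F + G) (L + M)"
  unfolding coeff_limit_def by (drule (1) tendsto_add) (simp add: add_divide_distrib)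

lemma coeff_limit_mult_X:
  assumes "a \<noteq> 0" and F: "coeff_limit a q F L"
  shows "coeff_limit a q (fps_X * F) (L / a)"
proof -
  have "(\<lambda>t. fps_nth F t / (a ^ t * of_nat (t choose q)) / a
      * (of_nat (t choose q) / of_nat (Suc t choose q))) \<longlonglongrightarrow> L / a * 1"
    using F \<open>a \<noteq> 0\<close> unfolding coeff_limit_def
    by (intro tendsto_mult tendsto_divide tendsto_const binomial_ratio_tendsto_1) auto
  moreover have "\<forall>\<^sub>F t in sequentially. fps_nth F t / (a ^ t * of_nat (t choose q)) / a
      * (of_nat (t choose q) / of_nat (Suc t choose q))
      = fps_nth (fps_X * F) (Suc t) / (a ^ Suc t * of_nat (Suc t choose q))"
    using eventually_binomial_nonzero[of q]
    by eventually_elim (simp add: field_simps del: binomial_Suc_Suc)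
  ultimately have "(\<lambda>t. fps_nth (fps_X * F) (Suc t) / (a ^ Suc t * of_nat (Suc t choose q)))
      \<longlonglongrightarrow> L / a"
    by (simp only: tendsto_cong mult_1_right)
  then show ?thesis
    unfolding coeff_limit_def by (rule LIMSEQ_imp_Suc)
qed

text \<open>Horner's scheme: multiplication by \<open>X\<close> acts on limits as multiplication by \<open>1 / a\<close>.\<close>

lemma coeff_limit_mult_poly:
  assumes "a \<noteq> 0" and F: "coeff_limit a q F L"
  shows "coeff_limit a q (fps_of_poly p * F) (poly p (1 / a) * L)"
proof (induction p)
  case 0
  then show ?case by (simp add: coeff_limit_def)
next
  case (pCons c p)
  have "coeff_limit a q (fps_const c * F + fps_X * (fps_of_poly p * F))
      (c * L + poly p (1 / a) * L / a)"
    by (intro coeff_limit_add coeff_limit_cmult F coeff_limit_mult_X pCons \<open>a \<noteq> 0\<close>)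
  then show ?case
    by (simp add: fps_of_poly_pCons algebra_simps flip: fps_const_neg)
qed

text \<open>The coefficients of \<open>G = F / (1 - \<mu>X)\<close> satisfy \<open>G\<^sub>t\<^sub>+\<^sub>1 = \<mu> G\<^sub>t + F\<^sub>t\<^sub>+\<^sub>1\<close>. After division by the
  weight, the factor \<open>\<mu>\<close> becomes asymptotically \<open>\<mu> / a\<close>, which lies inside the unit disc. The same
  argument would fail for \<open>\<mu> = a\<close>; the dominant factor is therefore treated by an explicit
  formula.\<close>

lemma coeff_limit_divide_linear:
  assumes "norm \<mu> < norm a" and F: "coeff_limit a q (fps_of_poly [:1, -\<mu>:] * G) L"
  shows "coeff_limit a q G (L / poly [:1, -\<mu>:] (1 / a))"
proof -
  have "a \<noteq> 0" using assms(1) by auto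
  define w where "w t = (of_nat (t choose q) :: complex)" for t
  define F where "F = fps_of_poly [:1, -\<mu>:] * G"
  define y where "y t = fps_nth G t / (a ^ t * w t)" for t
  define x where "x t = fps_nth F t / (a ^ t * w t)" for t
  have rec: "fps_nth G (Suc t) = \<mu> * fps_nth G t + fps_nth F (Suc t)" for t
    by (simp add: F_def fps_of_poly_pCons algebra_simps)
  have "y \<longlonglongrightarrow> L / (1 - \<mu> / a * 1)"
  proof (rule contracting_recursion_limit)
    show "(\<lambda>t. \<mu> / a * (w t / w (Suc t))) \<longlonglongrightarrow> \<mu> / a * 1"
      unfolding w_def by (intro tendsto_mult tendsto_const binomial_ratio_tendsto_1)
    show "norm (\<mu> / a * 1) < 1"
      using assms(1) \<open>a \<noteq> 0\<close> by (simp add: norm_divide)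
    show "(\<lambda>t. x (Suc t)) \<longlonglongrightarrow> L"
      using assms(2) unfolding coeff_limit_def x_def F_def w_def by (rule LIMSEQ_Suc)
    show "\<forall>\<^sub>F t in sequentially. y (Suc t) = \<mu> / a * (w t / w (Suc t)) * y t + x (Suc t)"
      using eventually_binomial_nonzero[of q]
    proof eventually_elim
      case (elim t)
      then have "w t \<noteq> 0" by (simp add: w_def)
      then show ?case
        using \<open>a \<noteq> 0\<close> by (simp add: y_def x_def rec add_divide_distrib mult_ac)
    qed
  qed
  then show ?thesis
    unfolding coeff_limit_def y_def w_def by (simp add: mult.commute)
qed

lemma coeff_limit_divide_linear_power:
  assumes "norm \<mu> < norm a"
  shows "coeff_limit a q (fps_of_poly ([:1, -\<mu>:] ^ n) * G) L \<Longrightarrow>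
    coeff_limit a q G (L / poly ([:1, -\<mu>:] ^ n) (1 / a))"
proof (induction n arbitrary: L)
  case (Suc n)
  from Suc.prems have
    "coeff_limit a q (fps_of_poly [:1, -\<mu>:] * (fps_of_poly ([:1, -\<mu>:] ^ n) * G)) L"
    by (simp only: power_Suc fps_of_poly_mult mult.assoc)
  then have "coeff_limit a q (fps_of_poly ([:1, -\<mu>:] ^ n) * G) (L / poly [:1, -\<mu>:] (1 / a))"
    by (rule coeff_limit_divide_linear[OF assms])
  from Suc.IH[OF this] show ?case
    by (simp only: power_Suc poly_mult divide_divide_eq_left)
qed simp

lemma coeff_limit_divide_prod:
  fixes \<mu> :: "'i \<Rightarrow> complex" and n :: "'i \<Rightarrow> nat"
  assumes "finite I" and "\<And>i. i \<in> I \<Longrightarrow> norm (\<mu> i) < norm a"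
  shows "coeff_limit a q (fps_of_poly (\<Prod>i\<in>I. [:1, -\<mu> i:] ^ n i) * G) L \<Longrightarrow>
    coeff_limit a q G (L / poly (\<Prod>i\<in>I. [:1, -\<mu> i:] ^ n i) (1 / a))"
  using assms
proof (induction I arbitrary: L rule: finite_induct)
  case (insert i I)
  let ?p = "[:1, -\<mu> i:] ^ n i" and ?q = "\<Prod>i\<in>I. [:1, -\<mu> i:] ^ n i"
  from insert.prems(1) have "coeff_limit a q (fps_of_poly ?p * (fps_of_poly ?q * G)) L"
    by (simp only: prod.insert[OF insert.hyps] fps_of_poly_mult mult.assoc)
  then have "coeff_limit a q (fps_of_poly ?q * G) (L / poly ?p (1 / a))"
    using insert.prems(2) by (intro coeff_limit_divide_linear_power) auto
  then have "coeff_limit a q G (L / poly ?p (1 / a) / poly ?q (1 / a))"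
    using insert.prems(2) by (intro insert.IH) auto
  then show ?case
    by (simp only: prod.insert[OF insert.hyps] poly_mult divide_divide_eq_left)
qed simp

lemma fps_of_linear_mult:
  fixes a :: complex
  shows "fps_of_poly [:1, -a:] * H = H - fps_const a * (fps_X * H)"
  by (simp add: fps_of_poly_pCons algebra_simps flip: fps_const_neg)

text \<open>The two inductions, on the exponent and on the index, turn multiplication by \<open>1 - aX\<close> into
  Pascal's rule.\<close>

lemma fps_nth_inverse_linear_power:
  fixes a :: complex
  assumes "fps_of_poly ([:1, -a:] ^ Suc q) * H = 1"
  shows "fps_nth H t = a ^ t * of_nat ((t + q) choose q)"
  using assms
proof (induction q arbitrary: H t)
  case 0
  then have *: "H = 1 + fps_const a * (fps_X * H)"
    using fps_of_linear_mult[of a H] by (simp add: algebra_simps)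
  show ?case
  proof (induction t)
    case 0
    from * have "fps_nth H 0 = fps_nth (1 + fps_const a * (fps_X * H)) 0" by simp
    then show ?case by simp
  next
    case (Suc t)
    from * have "fps_nth H (Suc t) = fps_nth (1 + fps_const a * (fps_X * H)) (Suc t)" by simp
    then show ?case using Suc by simp
  qed
next
  case (Suc q)
  define F where "F = fps_of_poly [:1, -a:] * H"
  have "fps_of_poly ([:1, -a:] ^ Suc q) * F = 1"
    unfolding F_def using Suc.prems by (simp only: power_Suc fps_of_poly_mult mult_ac)
  note F = Suc.IH[OF this]
  have H: "H = F + fps_const a * (fps_X * H)"
    unfolding F_def fps_of_linear_mult by simp
  show ?case
  proof (induction t)
    case 0
    from H have "fps_nth H 0 = fps_nth (F + fps_const a * (fps_X * H)) 0" by simp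
    then show ?case by (simp add: F)
  next
    case (Suc t)
    from H have "fps_nth H (Suc t) = fps_nth (F + fps_const a * (fps_X * H)) (Suc t)" by simp
    then show ?case using Suc by (simp add: F algebra_simps)
  qed
qed

lemma coeff_limit_inverse_linear_power:
  assumes "a \<noteq> 0" and "fps_of_poly ([:1, -a:] ^ Suc q) * H = 1"
  shows "coeff_limit a q H 1"
  using binomial_shift_ratio_tendsto_1[of q q] \<open>a \<noteq> 0\<close>
  by (simp add: coeff_limit_def fps_nth_inverse_linear_power[OF assms(2)])

section \<open>The generating functions of the reduction coefficients\<close>

text \<open>This is \<open>a\<^sub>j + a\<^sub>j\<^sub>-\<^sub>1 X + \<dots> + a\<^sub>0 X\<^sup>j\<close>. The recursive form mirrors the recursion of the generating
  functions: a shift by \<open>X\<close> and one new constant coefficient.\<close>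

fun reversed_trunc :: "complex poly \<Rightarrow> nat \<Rightarrow> complex poly" where
  "reversed_trunc P 0 = [:coeff P 0:]"
| "reversed_trunc P (Suc j) = pCons (coeff P (Suc j)) (reversed_trunc P j)"

lemma coeff_reversed_trunc:
  "coeff (reversed_trunc P j) i = (if i \<le> j then coeff P (j - i) else 0)"
  by (induction j arbitrary: i) (auto simp: coeff_pCons split: nat.split)

text \<open>The reversed truncations interpolate between \<open>a\<^sub>0\<close> and the reflected polynomial. This is what
  closes the system of equations for the generating functions.\<close>

lemma reversed_trunc_degree: "reversed_trunc P (degree P) = reflect_poly P"
  by (intro poly_eqI) (auto simp: coeff_reversed_trunc coeff_reflect_poly)

lemma poly_reversed_trunc:
  assumes "a \<noteq> 0"
  shows "poly (reversed_trunc P j) (1 / a) = poly (p_trunc P j) a / a ^ j"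
proof (induction j)
  case 0
  then show ?case by (simp add: p_trunc_def poly_monom)
next
  case (Suc j)
  have "poly (p_trunc P (Suc j)) a = poly (p_trunc P j) a + coeff P (Suc j) * a ^ Suc j"
    by (simp add: p_trunc_def poly_monom)
  then show ?case
    using Suc assms by (simp add: field_simps)
qed

definition b_fps :: "complex poly \<Rightarrow> nat \<Rightarrow> complex fps" where
  "b_fps P j = Abs_fps (\<lambda>t. b_step P t j)"

text \<open>Both the initial value \<open>- a\<^sub>j\<close> and the feedback term \<open>- a\<^sub>j b\<^sub>k\<^sub>-\<^sub>1(n)\<close> are captured by the single
  series \<open>- a\<^sub>j (1 + X B\<^sub>k\<^sub>-\<^sub>1)\<close>, so that \<open>B\<^sub>j = X B\<^sub>j\<^sub>-\<^sub>1 - a\<^sub>j (1 + X B\<^sub>k\<^sub>-\<^sub>1)\<close>, and induction on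
  \<open>j\<close> applies.\<close>

lemma b_fps_eq:
  "b_fps P j = - fps_of_poly (reversed_trunc P j) * (1 + fps_X * b_fps P (degree P - 1))"
proof (induction j)
  case 0
  have "fps_nth (b_fps P 0) t
      = fps_nth (- (fps_const (coeff P 0) * (1 + fps_X * b_fps P (degree P - 1)))) t" for t
    by (cases t) (auto simp: b_fps_def)
  then show ?case
    by (simp add: fps_eq_iff fps_of_poly_pCons)
next
  case (Suc j)
  have "fps_nth (b_fps P (Suc j)) t = fps_nth (fps_X * b_fps P j
      - fps_const (coeff P (Suc j)) * (1 + fps_X * b_fps P (degree P - 1))) t" for t
    by (cases t) (auto simp: b_fps_def)
  then have "b_fps P (Suc j) = fps_X * b_fps P j
      - fps_const (coeff P (Suc j)) * (1 + fps_X * b_fps P (degree P - 1))"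
    by (simp add: fps_eq_iff)
  moreover define G where "G = 1 + fps_X * b_fps P (degree P - 1)"
  ultimately have "b_fps P (Suc j) = fps_X * (- fps_of_poly (reversed_trunc P j) * G)
      - fps_const (coeff P (Suc j)) * G"
    using Suc by simp
  also have "\<dots> = - fps_of_poly (reversed_trunc P (Suc j)) * G"
    by (simp add: fps_of_poly_pCons algebra_simps flip: fps_const_neg)
  finally show ?case
    unfolding G_def .
qed

text \<open>The case \<open>j = k - 1\<close> of \<open>b_fps_eq\<close> is a linear equation for \<open>B\<^sub>k\<^sub>-\<^sub>1\<close>. Its solution identifies
  \<open>1 + X B\<^sub>k\<^sub>-\<^sub>1\<close> as the inverse of the reflected polynomial, which is
  \<open>1 + X (a\<^sub>k\<^sub>-\<^sub>1 + \<dots> + a\<^sub>0 X\<^sup>k\<^sup>-\<^sup>1)\<close> because \<open>P\<close> is monic.\<close>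

lemma reflect_poly_times_b_fps:
  assumes "lead_coeff P = 1" and "degree P > 0"
  shows "fps_of_poly (reflect_poly P) * (1 + fps_X * b_fps P (degree P - 1)) = 1"
proof -
  obtain d where d: "degree P = Suc d" using assms(2) by (cases "degree P") auto
  let ?G = "1 + fps_X * b_fps P d"
  have "fps_of_poly (reflect_poly P) = 1 + fps_X * fps_of_poly (reversed_trunc P d)"
    using assms(1) reversed_trunc_degree[of P]
    by (simp add: d fps_of_poly_pCons mult.commute flip: reversed_trunc_degree)
  then have "fps_of_poly (reflect_poly P) * ?G
      = ?G + fps_X * (fps_of_poly (reversed_trunc P d) * ?G)"
    by (simp only: distrib_right mult_1_left mult.assoc)
  also have "fps_of_poly (reversed_trunc P d) * ?G = - b_fps P d"
    using b_fps_eq[of P d] by (metis d diff_Suc_1 mult_minus_left minus_minus)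
  finally show ?thesis by (simp add: d)
qed

text \<open>One derivative turns the cofactor \<open>Q\<close> of \<open>(x - a)\<^sup>n\<^sup>+\<^sup>1\<close> into the cofactor \<open>(n + 1) Q + (x - a) Q'\<close>
  of \<open>(x - a)\<^sup>n\<close>, whose value at \<open>a\<close> is \<open>(n + 1) Q(a)\<close>. Hence the induction is over all
  \<open>Q\<close> simultaneously.\<close>

lemma higher_pderiv_at_root:
  fixes a :: complex
  shows "poly ((pderiv ^^ n) ([:-a, 1:] ^ n * Q)) a = fact n * poly Q a"
proof (induction n arbitrary: Q)
  case (Suc n)
  have "pderiv ([:-a, 1:] ^ Suc n * Q)
      = [:-a, 1:] ^ n * (Polynomial.smult (of_nat (Suc n)) Q + [:-a, 1:] * pderiv Q)"
    by (subst pderiv_mult, subst pderiv_power_Suc)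
      (simp add: pderiv_pCons algebra_simps smult_add_right del: of_nat_Suc)
  then have "(pderiv ^^ Suc n) ([:-a, 1:] ^ Suc n * Q)
      = (pderiv ^^ n) ([:-a, 1:] ^ n * (Polynomial.smult (of_nat (Suc n)) Q + [:-a, 1:] * pderiv Q))"
    by (simp only: funpow_Suc_right o_apply)
  then show ?case
    by (simp only: Suc.IH) (simp add: algebra_simps)
qed simp

lemma b_step_zero_eigenvalue:
  assumes "\<And>i. i < degree P \<Longrightarrow> coeff P i = 0" and "j < degree P"
  shows "b_step P t j = 0"
  using assms(2) by (induction t arbitrary: j) (auto simp: assms(1))

section \<open>The dominant eigenvalue\<close>

text \<open>The series \<open>Q\<^sup>* G\<close> is the inverse of \<open>(1 - aX)\<^sup>m\<close> and has limit 1; dividing by the factors of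
  \<open>Q\<^sup>*\<close> and multiplying by the reversed truncation gives the limit for \<open>b\<^sub>j\<close> relative to
  \<open>a\<^sup>N\<^sup>-\<^sup>k\<close>. The passage from \<open>a\<^sup>N\<^sup>-\<^sup>k\<close> to \<open>a\<^sup>N\<^sup>-\<^sup>m\<^sup>-\<^sup>j\<close> contributes the factor
  \<open>a\<^sup>j / a\<^sup>k\<^sup>-\<^sup>m\<close>, which cancels the powers of \<open>a\<close> coming from \<open>R\<^sub>j(1/a)\<close> and \<open>Q\<^sup>*(1/a)\<close>.\<close>

lemma b_coeff_ratio_tendsto:
  fixes Q :: "complex poly"
  assumes P: "P = [:-a, 1:] ^ m * Q" and Q: "Q = (\<Prod>i\<in>I. [:-\<mu> i, 1:] ^ n i)"
    and I: "finite I" "\<And>i. i \<in> I \<Longrightarrow> norm (\<mu> i) < norm a"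
    and "a \<noteq> 0" and "m \<ge> 1" and "j < degree P"
  shows "(\<lambda>N. b_coeff P j N / (a ^ (N - m - j) * of_nat ((N - degree P) choose (m - 1))))
    \<longlonglongrightarrow> - (poly (p_trunc P j) a / poly ((pderiv ^^ m) P) a) * fact m"
proof -
  let ?w = "\<lambda>t. of_nat (t choose (m - 1)) :: complex"
  have "lead_coeff Q = 1"
    unfolding Q by (simp add: lead_coeff_prod lead_coeff_power)
  then have lc: "lead_coeff P = 1"
    unfolding P by (simp add: lead_coeff_mult lead_coeff_power)
  from \<open>lead_coeff Q = 1\<close> have "Q \<noteq> 0" by auto
  then have deg: "degree P = m + degree Q"
    unfolding P by (simp add: degree_mult_eq degree_linear_power)
  have refl_linear: "reflect_poly [:-c, 1:] = [:1, -c:]" for c :: complex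
    by (cases "c = 0") (auto simp: reflect_poly_pCons reflect_poly_def)
  have rP: "reflect_poly P = [:1, -a:] ^ m * reflect_poly Q"
    unfolding P by (simp add: reflect_poly_mult reflect_poly_power refl_linear)
  have rQ: "reflect_poly Q = (\<Prod>i\<in>I. [:1, -\<mu> i:] ^ n i)"
    unfolding Q by (simp add: reflect_poly_prod reflect_poly_power refl_linear)
  define G where "G = 1 + fps_X * b_fps P (degree P - 1)"
  have "fps_of_poly (reflect_poly P) * G = 1"
    unfolding G_def using \<open>j < degree P\<close> by (intro reflect_poly_times_b_fps lc) simp
  then have "fps_of_poly ([:1, -a:] ^ Suc (m - 1)) * (fps_of_poly (reflect_poly Q) * G) = 1"
    using \<open>m \<ge> 1\<close> by (simp add: rP fps_of_poly_mult mult.assoc)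
  then have "coeff_limit a (m - 1) (fps_of_poly (reflect_poly Q) * G) 1"
    by (rule coeff_limit_inverse_linear_power[OF \<open>a \<noteq> 0\<close>])
  then have "coeff_limit a (m - 1) G (1 / poly (reflect_poly Q) (1 / a))"
    unfolding rQ by (intro coeff_limit_divide_prod I)
  moreover have "b_fps P j = fps_of_poly (- reversed_trunc P j) * G"
    unfolding G_def by (subst b_fps_eq) (simp add: fps_of_poly_uminus)
  ultimately have "coeff_limit a (m - 1) (b_fps P j)
      (poly (- reversed_trunc P j) (1 / a) * (1 / poly (reflect_poly Q) (1 / a)))"
    using coeff_limit_mult_poly[OF \<open>a \<noteq> 0\<close>] by metis
  also have "poly (reflect_poly Q) (1 / a) = poly Q a / a ^ degree Q"
    using \<open>a \<noteq> 0\<close> by (simp add: poly_reflect_poly_nz field_simps)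
  finally have "(\<lambda>t. b_step P t j / (a ^ t * ?w t)) \<longlonglongrightarrow>
      - (poly (p_trunc P j) a / a ^ j) * (a ^ degree Q / poly Q a)"
    using poly_reversed_trunc[OF \<open>a \<noteq> 0\<close>] by (simp add: coeff_limit_def b_fps_def)
  then have "(\<lambda>N. b_step P (N - degree P) j / (a ^ (N - degree P) * ?w (N - degree P)))
      \<longlonglongrightarrow> - (poly (p_trunc P j) a / a ^ j) * (a ^ degree Q / poly Q a)"
    by (rule filterlim_compose[OF _ filterlim_minus_const_nat_at_top])
  then have lim: "(\<lambda>N. b_step P (N - degree P) j / (a ^ (N - degree P) * ?w (N - degree P))
        * (a ^ j / a ^ degree Q))
      \<longlonglongrightarrow> - (poly (p_trunc P j) a / a ^ j) * (a ^ degree Q / poly Q a) * (a ^ j / a ^ degree Q)"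
    by (rule tendsto_mult_right)
  have "- (poly (p_trunc P j) a / a ^ j) * (a ^ degree Q / poly Q a) * (a ^ j / a ^ degree Q)
      = - (poly (p_trunc P j) a / poly Q a)"
    using \<open>a \<noteq> 0\<close> by (simp add: field_simps)
  also have "\<dots> = - (poly (p_trunc P j) a / poly ((pderiv ^^ m) P) a) * fact m"
    unfolding P higher_pderiv_at_root by simp
  finally have const_eq: "- (poly (p_trunc P j) a / a ^ j) * (a ^ degree Q / poly Q a)
      * (a ^ j / a ^ degree Q) = - (poly (p_trunc P j) a / poly ((pderiv ^^ m) P) a) * fact m" .
  have "\<forall>\<^sub>F N in sequentially.
      b_step P (N - degree P) j / (a ^ (N - degree P) * ?w (N - degree P)) * (a ^ j / a ^ degree Q)
      = b_coeff P j N / (a ^ (N - m - j) * ?w (N - degree P))"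
    \<comment> \<open>For \<open>N \<ge> k + j\<close> all subtractions of natural numbers in the exponents are exact.\<close>
    using eventually_ge_at_top[of "degree P + j"]
  proof eventually_elim
    case (elim N)
    have "(N - m - j) + j = (N - degree P) + degree Q"
      using elim deg by simp
    then have "a ^ (N - m - j) * a ^ j = a ^ (N - degree P) * a ^ degree Q"
      by (metis power_add)
    then have "a ^ (N - m - j) = a ^ (N - degree P) * a ^ degree Q / a ^ j"
      using \<open>a \<noteq> 0\<close> by (simp add: field_simps)
    then show ?case
      by (simp add: b_coeff_def)
  qed
  from tendsto_cong[THEN iffD1, OF this lim] show ?thesis
    unfolding const_eq .
qed

theorem theorem10:
  fixes A :: "complex mat" and P :: "complex poly"
    and k r :: nat and lam :: "nat \<Rightarrow> complex" and mult :: "nat \<Rightarrow> nat"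
  assumes "A \<in> carrier_mat k k"
    and "P = char_poly A"
    and "1 \<le> r" and "r \<le> k"
    and "P = (\<Prod>i=1..r. [:- lam i, 1:] ^ mult i)"
    and "\<And>i. 1 \<le> i \<Longrightarrow> i \<le> r \<Longrightarrow> 1 \<le> mult i"
    and "spectral_radius A = norm (lam 1)"
    and "\<And>i. 1 \<le> i \<Longrightarrow> i < r \<Longrightarrow> norm (lam (Suc i)) < norm (lam i)"
  shows "\<forall>j<k.
    (poly (p_trunc P j) (lam 1) \<noteq> 0 \<longrightarrow>
      (\<lambda>n. b_coeff P j n) \<sim>[at_top]
      (\<lambda>n. - (lam 1 ^ (n - mult 1 - j))
           * (poly (p_trunc P j) (lam 1) / poly ((pderiv ^^ mult 1) P) (lam 1))
           * fact (mult 1) * of_nat ((n - k) choose (mult 1 - 1)))) \<and>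
    (poly (p_trunc P j) (lam 1) = 0 \<longrightarrow>
      (\<lambda>n. b_coeff P j n) \<in>
      o[at_top](\<lambda>n. lam 1 ^ (n - mult 1 - j) * of_nat ((n - k) choose (mult 1 - 1))))"
proof -
  have k: "degree P = k"
    using degree_monic_char_poly[OF assms(1)] assms(2) by simp
  define Q where "Q = (\<Prod>i=2..r. [:- lam i, 1:] ^ mult i)"
  have "{1..r} = insert 1 {2..r}"
    using assms(3) by auto
  then have PQ: "P = [:- lam 1, 1:] ^ mult 1 * Q"
    unfolding assms(5) Q_def by simp
  have dominated: "norm (lam i) < norm (lam 1)" if "2 \<le> i" "i \<le> r" for i
    using that
  proof (induction i rule: dec_induct)
    case base
    then show ?case using assms(8)[of 1] by (simp add: numeral_2_eq_2)
  next
    case (step i)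
    then show ?case using assms(8)[of i] by simp
  qed
  show ?thesis
  proof (cases "lam 1 = 0")
    case True
    \<comment> \<open>No other eigenvalue can have a norm below 0.\<close>
    have "r = 1"
      using dominated[of 2] True assms(3) by (cases "r = 1") auto
    then have P: "P = monom 1 (mult 1)"
      using True unfolding assms(5) by (simp add: monom_altdef)
    then have "mult 1 = k"
      using k by (simp add: degree_monom_eq)
    then have zero: "coeff P i = 0" if "i < k" for i
      using that by (simp add: P)
    have "b_coeff P j n = 0" "poly (p_trunc P j) (lam 1) = 0" if "j < k" for j n
      using that b_step_zero_eigenvalue[of P j] zero
      by (auto simp: b_coeff_def k p_trunc_def poly_sum poly_monom)
    then show ?thesis by simp
  next
    case False
    show ?thesis
    proof (intro allI impI)
      fix j assume "j < k"
      define g where "g n = lam 1 ^ (n - mult 1 - j) * of_nat ((n - k) choose (mult 1 - 1))" for n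
      define C where "C = - (poly (p_trunc P j) (lam 1) / poly ((pderiv ^^ mult 1) P) (lam 1))
        * fact (mult 1)"
      have lim: "(\<lambda>n. b_coeff P j n / g n) \<longlonglongrightarrow> C"
        unfolding g_def C_def k[symmetric]
        by (rule b_coeff_ratio_tendsto[OF PQ Q_def])
          (use False \<open>j < k\<close> k dominated assms(3,6) in auto)
      have "poly Q (lam 1) \<noteq> 0"
        unfolding Q_def using dominated by (fastforce simp: poly_prod)
      then have deriv: "poly ((pderiv ^^ mult 1) P) (lam 1) \<noteq> 0"
        unfolding PQ higher_pderiv_at_root by simp
      have "b_coeff P j \<sim>[at_top] (\<lambda>n. C * g n)" if "poly (p_trunc P j) (lam 1) \<noteq> 0"
        using lim that deriv by (intro asymp_equivI'_const) (auto simp: C_def)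
      moreover have "b_coeff P j \<in> o[at_top](g)" if "poly (p_trunc P j) (lam 1) = 0"
      proof (rule smalloI_tendsto)
        show "(\<lambda>n. b_coeff P j n / g n) \<longlonglongrightarrow> 0"
          using lim that by (simp add: C_def)
        show "\<forall>\<^sub>F n in at_top. g n \<noteq> 0"
          using eventually_ge_at_top[of "k + mult 1"]
          by eventually_elim (use False in \<open>simp add: g_def\<close>)
      qed
      ultimately show "(poly (p_trunc P j) (lam 1) \<noteq> 0 \<longrightarrow>
          (\<lambda>n. b_coeff P j n) \<sim>[at_top]
          (\<lambda>n. - (lam 1 ^ (n - mult 1 - j))
             * (poly (p_trunc P j) (lam 1) / poly ((pderiv ^^ mult 1) P) (lam 1))
             * fact (mult 1) * of_nat ((n - k) choose (mult 1 - 1)))) \<and>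
        (poly (p_trunc P j) (lam 1) = 0 \<longrightarrow>
          (\<lambda>n. b_coeff P j n) \<in>
          o[at_top](\<lambda>n. lam 1 ^ (n - mult 1 - j) * of_nat ((n - k) choose (mult 1 - 1))))"
        by (simp add: g_def[abs_def] C_def mult_ac)
    qed
  qed
qed

end
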